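(* Let $X,Y,Z,W$ be normed spaces and let $f:X\times Y\times Z\to W$ be a bounded tri-linear map. The following statements are equivalent: (1) $f$ is regular. (2) $f^{*****}=f^{r*******r}$, i.e. $f^{*****}(w^{***},x^{**},y^{**})=f^{r*******r}(w^{***},x^{**},y^{**})$ in $Z^{***}$ for all $w^{***}\in W^{***}$, $x^{**}\in X^{**}$, $y^{**}\in Y^{**}$ (with $X^{**}\subseteq X^{****}$ and $Y^{**}\subseteq Y^{****}$ canonically). (3) $f^{***r*}(X^{**},W^{*},Z)\subseteq Y^{*}$ and $f^{*****}(W^{*},X^{**},Y^{**})\subseteq Z^{*}$.
   Context: Every normed space is identified with its canonical image in its second dual (so e.g. $Z\subseteq Z^{**}$, $Y^*\subseteq Y^{***}$, $W^*\subseteq W^{***}$). For a bounded tri-linear map $f:X\times Y\times Z\to W$ of normed spaces, its adjoint is the bounded tri-linear map $f^{*}:W^{*}\times X\times Y\to Z^{*}$, $\langle f^{*}(w^{*},x,y),z\rangle=\langle w^{*},f(x,y,z)\rangle$. Iterating, $f^{**}=(f^* )^*:Z^{**}\times W^{*}\times X\to Y^{*}$, $f^{***}=(f^{**})^*:Y^{**}\times Z^{**}\times W^{*}\to X^{*}$, $f^{****}=(f^{***})^*:X^{**}\times Y^{**}\times Z^{**}\to W^{**}$, and so on. The flip of a tri-linear map $f:X\times Y\times Z\to W$ is $f^{r}:Z\times Y\times X\to W$, $f^{r}(z,y,x)=f(x,y,z)$. Strings of $*$ and $r$ in a superscript are applied from left to right; e.g. $f^{r****r}=((f^{r})^{****})^{r}:X^{**}\times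 Y^{**}\times Z^{**}\to W^{**}$, $f^{***r*}=((f^{***})^r)^*:X^{**}\times W^{*}\times Z^{**}\to Y^{***}$, $f^{*****}:W^{***}\times X^{**}\times Y^{**}\to Z^{***}$, and $f^{r*******r}:W^{***}\times X^{****}\times Y^{****}\to Z^{***}$. The map $f$ is called regular if $f^{****}=f^{r****r}$. For a map $F$ and sets $P,Q,R$, $F(P,Q,R)$ denotes the set of values $F(p,q,r)$ with $p\in P$, $q\in Q$, $r\in R$. *)

theory Defs
  imports Complex_Main "HOL-Library.Function_Algebras"
begin

(* The paper does not fix the scalar field.  The scalar field is a type 'k of class
   real_normed_field (a commutative field extending the reals, with multiplicative norm), which by
   Mazur's theorem means the reals or the complex numbers.  The library's normed spaces and bounded
   linear maps (real_normed_vector, blinfun) have real scalars only, so normed spaces are given here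
   by a carrier, inside an ambient abelian group on which the scalars act. *)

record ('k, 'v) nspace =
  pts :: "'v set"
  scl :: "'k \<Rightarrow> 'v \<Rightarrow> 'v"
  nrm :: "'v \<Rightarrow> real"

definition normed_space :: "('k::real_normed_field, 'v::ab_group_add) nspace \<Rightarrow> bool" where
  "normed_space E \<longleftrightarrow>
     vector_space (scl E) \<and> module.subspace (scl E) (pts E) \<and>
     (\<forall>x\<in>pts E. 0 \<le> nrm E x \<and> (nrm E x = 0 \<longleftrightarrow> x = 0)) \<and>
     (\<forall>c. \<forall>x\<in>pts E. nrm E (scl E c x) = norm c * nrm E x) \<and>
     (\<forall>x\<in>pts E. \<forall>y\<in>pts E. nrm E (x + y) \<le> nrm E x + nrm E y)"

definition linear_betw ::
  "('k::real_normed_field, 'v::ab_group_add) nspace \<Rightarrow> ('k, 'u::ab_group_add) nspace \<Rightarrow> ('v \<Rightarrow> 'u) \<Rightarrow> bool"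
  where
  "linear_betw E F T \<longleftrightarrow>
     (\<forall>x\<in>pts E. T x \<in> pts F) \<and>
     (\<forall>x\<in>pts E. \<forall>y\<in>pts E. T (x + y) = T x + T y) \<and>
     (\<forall>c. \<forall>x\<in>pts E. T (scl E c x) = scl F c (T x))"

definition scalars :: "('k::real_normed_field, 'k) nspace" where
  "scalars = \<lparr>pts = UNIV, scl = (*), nrm = norm\<rparr>"

(* A functional is only meaningful on pts E; it is required to be 0 elsewhere, so that equality of
   elements of the dual space is equality of HOL functions.  Addition on 'v => 'k is pointwise
   (Function_Algebras); the norm is the operator norm. *)
definition dual ::
  "('k::real_normed_field, 'v::ab_group_add) nspace \<Rightarrow> ('k, 'v \<Rightarrow> 'k) nspace" where
  "dual E =
     \<lparr>pts = {\<phi>. linear_betw E scalars \<phi> \<and>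
               (\<exists>C. \<forall>x\<in>pts E. norm (\<phi> x) \<le> C * nrm E x) \<and>
               (\<forall>x. x \<notin> pts E \<longrightarrow> \<phi> x = 0)},
      scl = (\<lambda>c \<phi> x. c * \<phi> x),
      nrm = (\<lambda>\<phi>. SUP x\<in>{x \<in> pts E. nrm E x \<le> 1}. norm (\<phi> x))\<rparr>"

abbreviation bidual ::
  "('k::real_normed_field, 'v::ab_group_add) nspace \<Rightarrow> ('k, ('v \<Rightarrow> 'k) \<Rightarrow> 'k) nspace" where
  "bidual E \<equiv> dual (dual E)"

definition canon ::
  "('k::real_normed_field, 'v::ab_group_add) nspace \<Rightarrow> 'v \<Rightarrow> ('v \<Rightarrow> 'k) \<Rightarrow> 'k" where
  "canon E x = (\<lambda>\<phi>. if \<phi> \<in> pts (dual E) then \<phi> x else 0)"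

record ('k, 'x, 'y, 'z, 'w) trimap =
  src1 :: "('k, 'x) nspace"
  src2 :: "('k, 'y) nspace"
  src3 :: "('k, 'z) nspace"
  tgt :: "('k, 'w) nspace"
  app :: "'x \<Rightarrow> 'y \<Rightarrow> 'z \<Rightarrow> 'w"

definition bounded_trilinear ::
  "('k::real_normed_field, 'x::ab_group_add, 'y::ab_group_add, 'z::ab_group_add, 'w::ab_group_add) trimap \<Rightarrow> bool"
  where
  "bounded_trilinear f \<longleftrightarrow>
     (\<forall>y\<in>pts (src2 f). \<forall>z\<in>pts (src3 f). linear_betw (src1 f) (tgt f) (\<lambda>x. app f x y z)) \<and>
     (\<forall>x\<in>pts (src1 f). \<forall>z\<in>pts (src3 f). linear_betw (src2 f) (tgt f) (\<lambda>y. app f x y z)) \<and>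
     (\<forall>x\<in>pts (src1 f). \<forall>y\<in>pts (src2 f). linear_betw (src3 f) (tgt f) (\<lambda>z. app f x y z)) \<and>
     (\<exists>C. \<forall>x\<in>pts (src1 f). \<forall>y\<in>pts (src2 f). \<forall>z\<in>pts (src3 f).
        nrm (tgt f) (app f x y z) \<le> C * nrm (src1 f) x * nrm (src2 f) y * nrm (src3 f) z)"

definition adj ::
  "('k::real_normed_field, 'x::ab_group_add, 'y::ab_group_add, 'z::ab_group_add, 'w::ab_group_add) trimap
     \<Rightarrow> ('k, 'w \<Rightarrow> 'k, 'x, 'y, 'z \<Rightarrow> 'k) trimap"
  ("_\<^sup>\<star>" [1000] 1000) where
  "f\<^sup>\<star> =
     \<lparr>src1 = dual (tgt f), src2 = src1 f, src3 = src2 f, tgt = dual (src3 f),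
      app = (\<lambda>\<omega> x y z. if z \<in> pts (src3 f) then \<omega> (app f x y z) else 0)\<rparr>"

definition flip ::
  "('k, 'x, 'y, 'z, 'w) trimap \<Rightarrow> ('k, 'z, 'y, 'x, 'w) trimap"
  ("_\<^sup>r" [1000] 1000) where
  "f\<^sup>r = \<lparr>src1 = src3 f, src2 = src2 f, src3 = src1 f, tgt = tgt f, app = (\<lambda>z y x. app f x y z)\<rparr>"

definition regular ::
  "('k::real_normed_field, 'x::ab_group_add, 'y::ab_group_add, 'z::ab_group_add, 'w::ab_group_add) trimap \<Rightarrow> bool"
  where
  "regular f \<longleftrightarrow>
     (\<forall>x\<in>pts (bidual (src1 f)). \<forall>y\<in>pts (bidual (src2 f)). \<forall>z\<in>pts (bidual (src3 f)).
        app (f\<^sup>\<star>\<^sup>\<star>\<^sup>\<star>\<^sup>\<star>) x y z = app (f\<^sup>r\<^sup>\<star>\<^sup>\<star>\<^sup>\<star>\<^sup>\<star>\<^sup>r) x y z)"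

definition image3 :: "('k, 'x, 'y, 'z, 'w) trimap \<Rightarrow> 'x set \<Rightarrow> 'y set \<Rightarrow> 'z set \<Rightarrow> 'w set" where
  "image3 F P Q R = {app F p q r |p q r. p \<in> P \<and> q \<in> Q \<and> r \<in> R}"

(* Well-definedness: the normed spaces and maps built above are again normed spaces and bounded
   tri-linear maps, and every library normed space is an instance. *)

lemma normed_space_UNIV_real:
  "normed_space \<lparr>pts = UNIV :: 'a::real_normed_vector set, scl = scaleR, nrm = norm\<rparr>"
  unfolding normed_space_def
  by (auto simp: norm_triangle_ineq real_vector.vector_space_axioms
      module.subspace_def[OF module_iff_vector_space[THEN iffD2, OF real_vector.vector_space_axioms]])

lemma normed_space_scalars: "normed_space scalars"
proof -
  have "vector_space ((*) :: 'a::real_normed_field \<Rightarrow> _)"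
    by unfold_locales (auto simp: algebra_simps)
  then show ?thesis
    unfolding normed_space_def scalars_def
    by (auto simp: norm_mult norm_triangle_ineq module.subspace_def[OF module_iff_vector_space[THEN iffD2]])
qed

lemma normed_spaceD:
  assumes "normed_space E"
  shows "vector_space (scl E)" "0 \<in> pts E"
    "x \<in> pts E \<Longrightarrow> y \<in> pts E \<Longrightarrow> x + y \<in> pts E"
    "x \<in> pts E \<Longrightarrow> scl E c x \<in> pts E"
    "x \<in> pts E \<Longrightarrow> 0 \<le> nrm E x"
    "x \<in> pts E \<Longrightarrow> nrm E x = 0 \<longleftrightarrow> x = 0"
    "x \<in> pts E \<Longrightarrow> nrm E (scl E c x) = norm c * nrm E x"
    "x \<in> pts E \<Longrightarrow> y \<in> pts E \<Longrightarrow> nrm E (x + y) \<le> nrm E x + nrm E y"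
  using assms unfolding normed_space_def
  by (auto simp: module.subspace_def[OF module_iff_vector_space[THEN iffD2]])

lemma mem_dual_iff:
  "\<phi> \<in> pts (dual E) \<longleftrightarrow>
     (\<forall>x\<in>pts E. \<forall>y\<in>pts E. \<phi> (x + y) = \<phi> x + \<phi> y) \<and>
     (\<forall>c. \<forall>x\<in>pts E. \<phi> (scl E c x) = c * \<phi> x) \<and>
     (\<exists>C. \<forall>x\<in>pts E. norm (\<phi> x) \<le> C * nrm E x) \<and>
     (\<forall>x. x \<notin> pts E \<longrightarrow> \<phi> x = 0)"
  by (auto simp: dual_def linear_betw_def scalars_def)

lemma mem_dualI:
  assumes "\<And>x y. x \<in> pts E \<Longrightarrow> y \<in> pts E \<Longrightarrow> \<phi> (x + y) = \<phi> x + \<phi> y"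
    and "\<And>c x. x \<in> pts E \<Longrightarrow> \<phi> (scl E c x) = c * \<phi> x"
    and "\<And>x. x \<in> pts E \<Longrightarrow> norm (\<phi> x) \<le> C * nrm E x"
    and "\<And>x. x \<notin> pts E \<Longrightarrow> \<phi> x = 0"
  shows "\<phi> \<in> pts (dual E)"
  using assms unfolding mem_dual_iff by blast

lemma scl_dual: "scl (dual E) c \<phi> x = c * \<phi> x"
  by (simp add: dual_def)

lemma dual_bdd:
  assumes "normed_space E" "\<phi> \<in> pts (dual E)"
  shows "bdd_above ((\<lambda>x. norm (\<phi> x)) ` {x \<in> pts E. nrm E x \<le> 1})"
proof -
  obtain C where C: "\<forall>x\<in>pts E. norm (\<phi> x) \<le> C * nrm E x"
    using assms(2) by (auto simp: mem_dual_iff)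
  have "norm (\<phi> x) \<le> \<bar>C\<bar>" if "x \<in> pts E" "nrm E x \<le> 1" for x
  proof -
    have "norm (\<phi> x) \<le> C * nrm E x" using C that by auto
    also have "\<dots> \<le> \<bar>C\<bar> * nrm E x"
      using normed_spaceD(5)[OF assms(1) that(1)] by (intro mult_right_mono) auto
    also have "\<dots> \<le> \<bar>C\<bar> * 1" using that by (intro mult_left_mono) auto
    finally show ?thesis by simp
  qed
  then show ?thesis by (intro bdd_aboveI2) auto
qed

lemma nrm_dual_upper:
  assumes "normed_space E" "\<phi> \<in> pts (dual E)" "x \<in> pts E" "nrm E x \<le> 1"
  shows "norm (\<phi> x) \<le> nrm (dual E) \<phi>"
  using cSUP_upper[OF _ dual_bdd[OF assms(1,2)], of x] assms(3,4) by (simp add: dual_def)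

lemma nrm_dual_least:
  assumes "normed_space E" "\<And>x. x \<in> pts E \<Longrightarrow> nrm E x \<le> 1 \<Longrightarrow> norm (\<phi> x) \<le> B"
  shows "nrm (dual E) \<phi> \<le> B"
proof -
  have "(0 :: 'b) \<in> {x \<in> pts E. nrm E x \<le> 1}"
    using normed_spaceD(2)[OF assms(1)] normed_spaceD(6)[OF assms(1), of 0] by auto
  then show ?thesis using assms(2) unfolding dual_def by (auto intro!: cSUP_least)
qed

lemma norm_le_nrm_dual:
  assumes E: "normed_space E" and \<phi>: "\<phi> \<in> pts (dual E)" and x: "x \<in> pts E"
  shows "norm (\<phi> x) \<le> nrm (dual E) \<phi> * nrm E x"
proof (cases "nrm E x = 0")
  case True
  obtain C where "\<forall>x\<in>pts E. norm (\<phi> x) \<le> C * nrm E x"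
    using \<phi> by (auto simp: mem_dual_iff)
  then have "norm (\<phi> x) \<le> C * nrm E x" using x by blast
  then show ?thesis using True by simp
next
  case False
  then have pos: "nrm E x > 0" using normed_spaceD(5)[OF E x] by simp
  let ?c = "of_real (1 / nrm E x) :: 'a"
  have c: "norm ?c = 1 / nrm E x" using pos by (simp only: norm_of_real) simp
  have "norm (\<phi> (scl E ?c x)) \<le> nrm (dual E) \<phi>"
    by (rule nrm_dual_upper[OF E \<phi>])
      (use normed_spaceD(4,7)[OF E x, of ?c] pos c in auto)
  moreover have "\<phi> (scl E ?c x) = ?c * \<phi> x" using \<phi> x by (auto simp: mem_dual_iff)
  ultimately have "1 / nrm E x * norm (\<phi> x) \<le> nrm (dual E) \<phi>"
    by (metis c norm_mult)
  then show ?thesis using pos by (simp add: field_simps)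
qed

lemma normed_space_dual:
  fixes E :: "('k::real_normed_field, 'v::ab_group_add) nspace"
  assumes E: "normed_space E"
  shows "normed_space (dual E)"
proof -
  have vs: "vector_space (scl (dual E))"
    by unfold_locales (auto simp: fun_eq_iff scl_dual algebra_simps)
  have z: "0 \<in> pts (dual E)" by (auto simp: mem_dual_iff intro!: exI[of _ 0])
  have add: "\<phi> + \<psi> \<in> pts (dual E)" if "\<phi> \<in> pts (dual E)" "\<psi> \<in> pts (dual E)" for \<phi> \<psi>
  proof -
    have "norm ((\<phi> + \<psi>) x) \<le> (nrm (dual E) \<phi> + nrm (dual E) \<psi>) * nrm E x" if "x \<in> pts E" for x
      using norm_le_nrm_dual[OF E \<open>\<phi> \<in> _\<close> that] norm_le_nrm_dual[OF E \<open>\<psi> \<in> _\<close> that]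
        norm_triangle_ineq[of "\<phi> x" "\<psi> x"]
      by (simp add: distrib_right)
    with that show ?thesis
      by (intro mem_dualI[where C="nrm (dual E) \<phi> + nrm (dual E) \<psi>"])
        (auto simp: mem_dual_iff[of \<phi>] mem_dual_iff[of \<psi>] distrib_left)
  qed
  have scale: "scl (dual E) c \<phi> \<in> pts (dual E)" if "\<phi> \<in> pts (dual E)" for c \<phi>
  proof -
    have "norm (scl (dual E) c \<phi> x) \<le> (norm c * nrm (dual E) \<phi>) * nrm E x" if "x \<in> pts E" for x
      using norm_le_nrm_dual[OF E \<open>\<phi> \<in> _\<close> that]
      by (simp add: scl_dual norm_mult mult.assoc mult_left_mono)
    with that show ?thesis
      by (intro mem_dualI[where C="norm c * nrm (dual E) \<phi>"])
        (auto simp: mem_dual_iff[of \<phi>] scl_dual distrib_left)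
  qed
  have sub: "module.subspace (scl (dual E)) (pts (dual E))"
    using z add scale by (simp add: module.subspace_def[OF module_iff_vector_space[THEN iffD2, OF vs]])
  have nonneg: "0 \<le> nrm (dual E) \<phi>" if "\<phi> \<in> pts (dual E)" for \<phi>
    using order_trans[OF norm_ge_zero nrm_dual_upper[OF E that, of 0]]
      normed_spaceD(2)[OF E] normed_spaceD(6)[OF E, of 0] by simp
  have zero: "nrm (dual E) \<phi> = 0 \<longleftrightarrow> \<phi> = 0" if \<phi>: "\<phi> \<in> pts (dual E)" for \<phi>
  proof
    assume 0: "nrm (dual E) \<phi> = 0"
    have "\<phi> x = 0" for x
      using norm_le_nrm_dual[OF E \<phi>, of x] 0 \<phi> by (cases "x \<in> pts E") (auto simp: mem_dual_iff)
    then show "\<phi> = 0" by (simp add: fun_eq_iff)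
  next
    assume "\<phi> = 0"
    then have "nrm (dual E) \<phi> \<le> 0" by (intro nrm_dual_least[OF E]) auto
    then show "nrm (dual E) \<phi> = 0" using nonneg[OF \<phi>] by simp
  qed
  have tri: "nrm (dual E) (\<phi> + \<psi>) \<le> nrm (dual E) \<phi> + nrm (dual E) \<psi>"
    if "\<phi> \<in> pts (dual E)" "\<psi> \<in> pts (dual E)" for \<phi> \<psi>
  proof (rule nrm_dual_least[OF E])
    fix x assume "x \<in> pts E" "nrm E x \<le> 1"
    then show "norm ((\<phi> + \<psi>) x) \<le> nrm (dual E) \<phi> + nrm (dual E) \<psi>"
      using nrm_dual_upper[OF E that(1)] nrm_dual_upper[OF E that(2)]
      by (auto intro: norm_triangle_mono)
  qed
  have le: "nrm (dual E) (scl (dual E) c \<phi>) \<le> norm c * nrm (dual E) \<phi>" if "\<phi> \<in> pts (dual E)" for c \<phi>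
    using nrm_dual_upper[OF E that]
    by (intro nrm_dual_least[OF E]) (auto simp: scl_dual norm_mult intro!: mult_left_mono)
  have hom: "nrm (dual E) (scl (dual E) c \<phi>) = norm c * nrm (dual E) \<phi>" if \<phi>: "\<phi> \<in> pts (dual E)" for c \<phi>
  proof (cases "c = 0")
    case True
    then have "scl (dual E) c \<phi> = 0" by (simp add: fun_eq_iff scl_dual)
    then show ?thesis using True zero[OF z] by simp
  next
    case False
    have "scl (dual E) (inverse c) (scl (dual E) c \<phi>) = \<phi>"
      using False by (simp add: fun_eq_iff scl_dual)
    with le[OF scale[OF \<phi>], of "inverse c" c]
    have "nrm (dual E) \<phi> \<le> norm (inverse c) * nrm (dual E) (scl (dual E) c \<phi>)" by simp
    then have "norm c * nrm (dual E) \<phi> \<le> nrm (dual E) (scl (dual E) c \<phi>)"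
      using False by (simp add: norm_inverse norm_divide field_simps)
    then show ?thesis using le[OF \<phi>, of c] by simp
  qed
  show ?thesis unfolding normed_space_def using vs sub nonneg zero tri hom by auto
qed

lemma canon_mem_bidual:
  assumes E: "normed_space E" and x: "x \<in> pts E"
  shows "canon E x \<in> pts (bidual E)"
proof -
  have "norm (canon E x \<phi>) \<le> nrm E x * nrm (dual E) \<phi>" if "\<phi> \<in> pts (dual E)" for \<phi>
    using norm_le_nrm_dual[OF E that x] that by (simp add: canon_def mult.commute)
  then show ?thesis
    using normed_spaceD(3,4)[OF normed_space_dual[OF E]]
    by (intro mem_dualI[where C="nrm E x"]) (auto simp: canon_def scl_dual)
qed

lemma bounded_trilinear_flip:
  assumes "bounded_trilinear f"
  shows "bounded_trilinear (f\<^sup>r)"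
proof -
  obtain C where "\<forall>x\<in>pts (src1 f). \<forall>y\<in>pts (src2 f). \<forall>z\<in>pts (src3 f).
      nrm (tgt f) (app f x y z) \<le> C * nrm (src1 f) x * nrm (src2 f) y * nrm (src3 f) z"
    using assms unfolding bounded_trilinear_def by blast
  then have "\<exists>C. \<forall>z\<in>pts (src3 f). \<forall>y\<in>pts (src2 f). \<forall>x\<in>pts (src1 f).
      nrm (tgt f) (app f x y z) \<le> C * nrm (src3 f) z * nrm (src2 f) y * nrm (src1 f) x"
    by (intro exI[of _ C]) (simp add: mult_ac)
  then show ?thesis using assms by (simp add: bounded_trilinear_def flip_def)
qed

lemma bounded_trilinear_adj:
  assumes X: "normed_space (src1 f)" and Y: "normed_space (src2 f)" and Z: "normed_space (src3 f)"
    and W: "normed_space (tgt f)" and f: "bounded_trilinear f"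
  shows "bounded_trilinear (f\<^sup>\<star>)"
proof -
  have lin [simp]:
    "app f x y z \<in> pts (tgt f)"
    "x' \<in> pts (src1 f) \<Longrightarrow> app f (x + x') y z = app f x y z + app f x' y z"
    "y' \<in> pts (src2 f) \<Longrightarrow> app f x (y + y') z = app f x y z + app f x y' z"
    "z' \<in> pts (src3 f) \<Longrightarrow> app f x y (z + z') = app f x y z + app f x y z'"
    "app f (scl (src1 f) c x) y z = scl (tgt f) c (app f x y z)"
    "app f x (scl (src2 f) c y) z = scl (tgt f) c (app f x y z)"
    "app f x y (scl (src3 f) c z) = scl (tgt f) c (app f x y z)"
    if "x \<in> pts (src1 f)" "y \<in> pts (src2 f)" "z \<in> pts (src3 f)" for x y z x' y' z' c
    using f that unfolding bounded_trilinear_def linear_betw_def by simp_all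
  have dlin [simp]: "v \<in> pts (tgt f) \<Longrightarrow> \<omega> (u + v) = \<omega> u + \<omega> v" "\<omega> (scl (tgt f) c u) = c * \<omega> u"
    if "\<omega> \<in> pts (dual (tgt f))" "u \<in> pts (tgt f)" for \<omega> u v c
    using that by (auto simp: mem_dual_iff)
  obtain C0 where C0: "\<And>x y z. x \<in> pts (src1 f) \<Longrightarrow> y \<in> pts (src2 f) \<Longrightarrow> z \<in> pts (src3 f) \<Longrightarrow>
      nrm (tgt f) (app f x y z) \<le> C0 * nrm (src1 f) x * nrm (src2 f) y * nrm (src3 f) z"
    using f unfolding bounded_trilinear_def by blast
  define C where "C = \<bar>C0\<bar>"
  have C: "nrm (tgt f) (app f x y z) \<le> C * nrm (src1 f) x * nrm (src2 f) y * nrm (src3 f) z"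
    if "x \<in> pts (src1 f)" "y \<in> pts (src2 f)" "z \<in> pts (src3 f)" for x y z
    using C0[OF that] normed_spaceD(5)[OF X that(1)] normed_spaceD(5)[OF Y that(2)]
      normed_spaceD(5)[OF Z that(3)] unfolding C_def
    by (meson abs_ge_self mult_right_mono order_trans)
  have B: "norm (\<omega> (app f x y z)) \<le>
      (C * nrm (dual (tgt f)) \<omega> * nrm (src1 f) x * nrm (src2 f) y) * nrm (src3 f) z"
    if "\<omega> \<in> pts (dual (tgt f))" "x \<in> pts (src1 f)" "y \<in> pts (src2 f)" "z \<in> pts (src3 f)" for \<omega> x y z
  proof -
    have "norm (\<omega> (app f x y z)) \<le> nrm (dual (tgt f)) \<omega> * nrm (tgt f) (app f x y z)"
      using that by (intro norm_le_nrm_dual[OF W]) auto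
    also have "\<dots> \<le> nrm (dual (tgt f)) \<omega> * (C * nrm (src1 f) x * nrm (src2 f) y * nrm (src3 f) z)"
      by (intro mult_left_mono C that normed_spaceD(5)[OF normed_space_dual[OF W]])
    finally show ?thesis by (simp add: algebra_simps)
  qed
  have mem: "app (f\<^sup>\<star>) \<omega> x y \<in> pts (dual (src3 f))"
    if "\<omega> \<in> pts (dual (tgt f))" "x \<in> pts (src1 f)" "y \<in> pts (src2 f)" for \<omega> x y
    using that B[OF that] normed_spaceD(3,4)[OF Z]
    by (intro mem_dualI[where C="C * nrm (dual (tgt f)) \<omega> * nrm (src1 f) x * nrm (src2 f) y"])
      (auto simp: adj_def)
  have "nrm (dual (src3 f)) (app (f\<^sup>\<star>) \<omega> x y) \<le> C * nrm (dual (tgt f)) \<omega> * nrm (src1 f) x * nrm (src2 f) y"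
    if "\<omega> \<in> pts (dual (tgt f))" "x \<in> pts (src1 f)" "y \<in> pts (src2 f)" for \<omega> x y
  proof (rule nrm_dual_least[OF Z])
    fix z assume z: "z \<in> pts (src3 f)" "nrm (src3 f) z \<le> 1"
    have nn: "0 \<le> C * nrm (dual (tgt f)) \<omega> * nrm (src1 f) x * nrm (src2 f) y"
      using that normed_spaceD(5)[OF X] normed_spaceD(5)[OF Y] normed_spaceD(5)[OF normed_space_dual[OF W]]
      by (auto simp: C_def)
    show "norm (app (f\<^sup>\<star>) \<omega> x y z) \<le> C * nrm (dual (tgt f)) \<omega> * nrm (src1 f) x * nrm (src2 f) y"
      using B[OF that z(1)] mult_left_mono[OF z(2) nn] z by (simp add: adj_def)
  qed
  moreover have "linear_betw (dual (tgt f)) (dual (src3 f)) (\<lambda>\<omega>. app (f\<^sup>\<star>) \<omega> x y)"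
    if "x \<in> pts (src1 f)" "y \<in> pts (src2 f)" for x y
    using mem that normed_spaceD(3,4)[OF normed_space_dual[OF W]]
    by (auto simp: linear_betw_def fun_eq_iff scl_dual) (auto simp: adj_def scl_dual)
  moreover have "linear_betw (src1 f) (dual (src3 f)) (\<lambda>x. app (f\<^sup>\<star>) \<omega> x y)"
    if "\<omega> \<in> pts (dual (tgt f))" "y \<in> pts (src2 f)" for \<omega> y
    using mem that normed_spaceD(3,4)[OF X] normed_spaceD(3,4)[OF Y]
    by (auto simp: linear_betw_def fun_eq_iff scl_dual) (auto simp: adj_def)
  moreover have "linear_betw (src2 f) (dual (src3 f)) (\<lambda>y. app (f\<^sup>\<star>) \<omega> x y)"
    if "\<omega> \<in> pts (dual (tgt f))" "x \<in> pts (src1 f)" for \<omega> x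
    using mem that normed_spaceD(3,4)[OF X] normed_spaceD(3,4)[OF Y]
    by (auto simp: linear_betw_def fun_eq_iff scl_dual) (auto simp: adj_def)
  ultimately show ?thesis unfolding bounded_trilinear_def by (auto simp: adj_def)
qed

end

theory Submission
  imports Defs
begin

text \<open>
  Write $g = f^r$. On a functional $w^*$ the maps $f^{****}$ and $g^{****}$ are iterated weak-star
  limits of $w^*(f(x,y,z))$ in opposite orders. For (2), evaluating $g^{*******}$ at canonical
  images collapses it to $w^{***} \circ g^{****}$, and the canonical images of $W^*$ already
  separate the points of $W^{**}$. For (3), the limit order of $f^{****}$ is reversed one variable
  at a time: an element of $Y^{***}$ or $Z^{***}$ lying in $Y^*$ or $Z^*$ is determined by its
  values on $Y$ or $Z$, where the next limit can be interchanged.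
\<close>

text \<open>Members of a dual vanish off the carrier by convention, so agreement on the carrier is
  already equality of functions.\<close>

lemma dual_eqI:
  assumes "\<phi> \<in> pts (dual E)" "\<psi> \<in> pts (dual E)" "\<And>x. x \<in> pts E \<Longrightarrow> \<phi> x = \<psi> x"
  shows "\<phi> = \<psi>"
  using assms by (metis ext mem_dual_iff)

lemma canon_apply [simp]: "\<phi> \<in> pts (dual E) \<Longrightarrow> canon E x \<phi> = \<phi> x"
  by (simp add: canon_def)

text \<open>Each rewrite of an evaluated adjoint peels off one star and leaves its defining pairing;
  the side condition excludes the default value 0 taken off the carrier.\<close>

lemma adj_simps [simp]:
  "src1 (f\<^sup>\<star>) = dual (tgt f)" "src2 (f\<^sup>\<star>) = src1 f" "src3 (f\<^sup>\<star>) = src2 f"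
  "tgt (f\<^sup>\<star>) = dual (src3 f)"
  "z \<in> pts (src3 f) \<Longrightarrow> app (f\<^sup>\<star>) \<omega> x y z = \<omega> (app f x y z)"
  by (simp_all add: adj_def)

lemma flip_simps [simp]:
  "src1 (f\<^sup>r) = src3 f" "src2 (f\<^sup>r) = src2 f" "src3 (f\<^sup>r) = src1 f"
  "tgt (f\<^sup>r) = tgt f" "app (f\<^sup>r) z y x = app f x y z"
  by (simp_all add: flip_def)

text \<open>Bundled so that closure under adjoint and flip becomes a pair of simp rules, which carry
  the hypotheses through any string of stars and flips.\<close>

definition normed_trimap ::
  "('k::real_normed_field, 'x::ab_group_add, 'y::ab_group_add, 'z::ab_group_add, 'w::ab_group_add) trimap \<Rightarrow> bool"
  where
  "normed_trimap f \<longleftrightarrow> normed_space (src1 f) \<and> normed_space (src2 f) \<and> normed_space (src3 f) \<and>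
     normed_space (tgt f) \<and> bounded_trilinear f"

lemma normed_trimap_adj [simp]: "normed_trimap f \<Longrightarrow> normed_trimap (f\<^sup>\<star>)"
  by (simp add: normed_trimap_def normed_space_dual bounded_trilinear_adj)

lemma normed_trimap_flip [simp]: "normed_trimap f \<Longrightarrow> normed_trimap (f\<^sup>r)"
  by (simp add: normed_trimap_def bounded_trilinear_flip)

lemma app_mem:
  assumes "normed_trimap f" "x \<in> pts (src1 f)" "y \<in> pts (src2 f)" "z \<in> pts (src3 f)"
  shows "app f x y z \<in> pts (tgt f)"
  using assms by (auto simp: normed_trimap_def bounded_trilinear_def linear_betw_def)

text \<open>The premise \<open>E = src3 f\<close> keeps \<open>E\<close> free in the conclusion, so
  the rule still matches once the simplifier has rewritten \<open>src3\<close> of an iterated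
  adjoint to an explicit space.\<close>

lemma app_adj_mem [simp]:
  assumes "normed_trimap f" "\<omega> \<in> pts (dual (tgt f))" "x \<in> pts (src1 f)" "y \<in> pts (src2 f)" "E = src3 f"
  shows "app (f\<^sup>\<star>) \<omega> x y \<in> pts (dual E)"
  using app_mem[of "f\<^sup>\<star>"] assms by simp

lemma canon_mem:
  assumes "normed_trimap f"
  shows "y \<in> pts (src2 f) \<Longrightarrow> canon (src2 f) y \<in> pts (bidual (src2 f))"
    and "z \<in> pts (src3 f) \<Longrightarrow> canon (src3 f) z \<in> pts (bidual (src3 f))"
  using assms by (auto simp: normed_trimap_def canon_mem_bidual)

lemma canon_dual_mem:
  assumes "normed_trimap f"
  shows "x \<in> pts (bidual (src1 f)) \<Longrightarrow> canon (bidual (src1 f)) x \<in> pts (bidual (bidual (src1 f)))"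
    and "y \<in> pts (bidual (src2 f)) \<Longrightarrow> canon (bidual (src2 f)) y \<in> pts (bidual (bidual (src2 f)))"
    and "w \<in> pts (dual (tgt f)) \<Longrightarrow> canon (dual (tgt f)) w \<in> pts (bidual (dual (tgt f)))"
  using assms by (auto simp: normed_trimap_def canon_mem_bidual normed_space_dual)

text \<open>Members of $W^{**}$ are functions on $W^*$, so the equation can be tested at each $w$ in
  $W^*$; the outer flip of $f^{r****r}$ only reorders the arguments.\<close>

lemma regular_iff:
  assumes "normed_trimap f"
  shows "regular f \<longleftrightarrow>
    (\<forall>x\<in>pts (bidual (src1 f)). \<forall>y\<in>pts (bidual (src2 f)). \<forall>z\<in>pts (bidual (src3 f)).
       \<forall>w\<in>pts (dual (tgt f)). app (f\<^sup>\<star>\<^sup>\<star>\<^sup>\<star>\<^sup>\<star>) x y z w = app (f\<^sup>r\<^sup>\<star>\<^sup>\<star>\<^sup>\<star>\<^sup>\<star>) z y x w)"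
  unfolding regular_def
proof (intro ball_cong refl iffI ballI)
  fix x y z
  assume "x \<in> pts (bidual (src1 f))" "y \<in> pts (bidual (src2 f))" "z \<in> pts (bidual (src3 f))"
    and "\<forall>w\<in>pts (dual (tgt f)). app (f\<^sup>\<star>\<^sup>\<star>\<^sup>\<star>\<^sup>\<star>) x y z w = app (f\<^sup>r\<^sup>\<star>\<^sup>\<star>\<^sup>\<star>\<^sup>\<star>) z y x w"
  with assms show "app (f\<^sup>\<star>\<^sup>\<star>\<^sup>\<star>\<^sup>\<star>) x y z = app (f\<^sup>r\<^sup>\<star>\<^sup>\<star>\<^sup>\<star>\<^sup>\<star>\<^sup>r) x y z"
    by (intro dual_eqI[where E="dual (tgt f)"]) auto
qed simp

text \<open>Three adjoints unwind: the canonical image of $y$ turns the value at $z$ into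
  $g^{******}$ evaluated at $y$, that of $x$ turns this into $g^{*****}$ evaluated at $x$, and the
  last star is the pairing with $w$.\<close>

lemma app_flip_adj7_canon:
  assumes "normed_trimap f"
    and "w \<in> pts (dual (bidual (tgt f)))" "x \<in> pts (bidual (src1 f))"
      "y \<in> pts (bidual (src2 f))" "z \<in> pts (bidual (src3 f))"
  shows "app (f\<^sup>r\<^sup>\<star>\<^sup>\<star>\<^sup>\<star>\<^sup>\<star>\<^sup>\<star>\<^sup>\<star>\<^sup>\<star>\<^sup>r) w (canon (bidual (src1 f)) x) (canon (bidual (src2 f)) y) z
    = w (app (f\<^sup>r\<^sup>\<star>\<^sup>\<star>\<^sup>\<star>\<^sup>\<star>) z y x)"
  using assms by (simp add: canon_dual_mem)

lemma regular_iff_adj5_eq: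
  assumes f: "normed_trimap f"
  shows "regular f \<longleftrightarrow>
    (\<forall>w\<in>pts (dual (bidual (tgt f))). \<forall>x\<in>pts (bidual (src1 f)). \<forall>y\<in>pts (bidual (src2 f)).
       app (f\<^sup>\<star>\<^sup>\<star>\<^sup>\<star>\<^sup>\<star>\<^sup>\<star>) w x y =
       app (f\<^sup>r\<^sup>\<star>\<^sup>\<star>\<^sup>\<star>\<^sup>\<star>\<^sup>\<star>\<^sup>\<star>\<^sup>\<star>\<^sup>r) w (canon (bidual (src1 f)) x) (canon (bidual (src2 f)) y))"
    (is "_ \<longleftrightarrow> ?eq")
proof
  assume reg: "regular f"
  show ?eq
  proof (intro ballI)
    fix w x y
    assume wxy: "w \<in> pts (dual (bidual (tgt f)))" "x \<in> pts (bidual (src1 f))" "y \<in> pts (bidual (src2 f))"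
    show "app (f\<^sup>\<star>\<^sup>\<star>\<^sup>\<star>\<^sup>\<star>\<^sup>\<star>) w x y =
       app (f\<^sup>r\<^sup>\<star>\<^sup>\<star>\<^sup>\<star>\<^sup>\<star>\<^sup>\<star>\<^sup>\<star>\<^sup>\<star>\<^sup>r) w (canon (bidual (src1 f)) x) (canon (bidual (src2 f)) y)"
    proof (rule dual_eqI[where E="bidual (src3 f)"])
      fix z assume "z \<in> pts (bidual (src3 f))"
      with reg wxy show "app (f\<^sup>\<star>\<^sup>\<star>\<^sup>\<star>\<^sup>\<star>\<^sup>\<star>) w x y z =
         app (f\<^sup>r\<^sup>\<star>\<^sup>\<star>\<^sup>\<star>\<^sup>\<star>\<^sup>\<star>\<^sup>\<star>\<^sup>\<star>\<^sup>r) w (canon (bidual (src1 f)) x) (canon (bidual (src2 f)) y) z"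
        by (subst app_flip_adj7_canon[OF f]) (simp_all add: regular_def)
    qed (use f wxy in \<open>simp_all add: canon_dual_mem\<close>)
  qed
next
  assume eq: ?eq
  show "regular f"
    unfolding regular_iff[OF f]
  proof (intro ballI)
    fix x y z w
    assume xyz: "x \<in> pts (bidual (src1 f))" "y \<in> pts (bidual (src2 f))" "z \<in> pts (bidual (src3 f))"
      and w: "w \<in> pts (dual (tgt f))"
    \<comment> \<open>On $W^{**}$ this functional is evaluation at \<open>w\<close>, so
      \<open>eq\<close> taken at \<open>?w\<close> compares the two fourth adjoints at
      \<open>w\<close>.\<close>
    let ?w = "canon (dual (tgt f)) w"
    have w': "?w \<in> pts (dual (bidual (tgt f)))" using canon_dual_mem(3)[OF f w] .
    have "?w (app (f\<^sup>\<star>\<^sup>\<star>\<^sup>\<star>\<^sup>\<star>) x y z) = app (f\<^sup>\<star>\<^sup>\<star>\<^sup>\<star>\<^sup>\<star>\<^sup>\<star>) ?w x y z"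
      using xyz by simp
    also have "\<dots> = ?w (app (f\<^sup>r\<^sup>\<star>\<^sup>\<star>\<^sup>\<star>\<^sup>\<star>) z y x)"
      using eq w' xyz by (simp only: app_flip_adj7_canon[OF f w' xyz])
    finally show "app (f\<^sup>\<star>\<^sup>\<star>\<^sup>\<star>\<^sup>\<star>) x y z w = app (f\<^sup>r\<^sup>\<star>\<^sup>\<star>\<^sup>\<star>\<^sup>\<star>) z y x w"
      using f xyz by simp
  qed
qed

text \<open>Under regularity the required preimages are explicit: $g^{**}(x,w,z)$ in $Y^*$ and
  $g^{***}(y,x,w)$ in $Z^*$. The converse shows that any preimages must be these.\<close>

lemma regular_iff_adj_images:
  assumes f: "normed_trimap f"
  shows "regular f \<longleftrightarrow>
    image3 (f\<^sup>\<star>\<^sup>\<star>\<^sup>\<star>\<^sup>r\<^sup>\<star>) (pts (bidual (src1 f))) (pts (dual (tgt f))) (canon (src3 f) ` pts (src3 f))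
      \<subseteq> canon (dual (src2 f)) ` pts (dual (src2 f))
    \<and>
    image3 (f\<^sup>\<star>\<^sup>\<star>\<^sup>\<star>\<^sup>\<star>\<^sup>\<star>) (canon (dual (tgt f)) ` pts (dual (tgt f))) (pts (bidual (src1 f))) (pts (bidual (src2 f)))
      \<subseteq> canon (dual (src3 f)) ` pts (dual (src3 f))"
    (is "_ \<longleftrightarrow> ?im2 \<and> ?im3")
proof (intro iffI conjI)
  assume "regular f"
  then have reg: "app (f\<^sup>\<star>\<^sup>\<star>\<^sup>\<star>\<^sup>\<star>) x y z w = app (f\<^sup>r\<^sup>\<star>\<^sup>\<star>\<^sup>\<star>\<^sup>\<star>) z y x w"
    if "x \<in> pts (bidual (src1 f))" "y \<in> pts (bidual (src2 f))" "z \<in> pts (bidual (src3 f))"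
      "w \<in> pts (dual (tgt f))" for x y z w
    using that regular_iff[OF f] by blast
  show ?im2
  proof -
    have "app (f\<^sup>\<star>\<^sup>\<star>\<^sup>\<star>\<^sup>r\<^sup>\<star>) x w (canon (src3 f) z) = canon (dual (src2 f)) (app (f\<^sup>r\<^sup>\<star>\<^sup>\<star>) x w z)"
      if x: "x \<in> pts (bidual (src1 f))" and w: "w \<in> pts (dual (tgt f))" and z: "z \<in> pts (src3 f)" for x w z
    proof (rule dual_eqI[where E="bidual (src2 f)"])
      fix y assume y: "y \<in> pts (bidual (src2 f))"
      have "app (f\<^sup>\<star>\<^sup>\<star>\<^sup>\<star>\<^sup>r\<^sup>\<star>) x w (canon (src3 f) z) y = app (f\<^sup>\<star>\<^sup>\<star>\<^sup>\<star>\<^sup>\<star>) x y (canon (src3 f) z) w"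
        using w y by simp
      \<comment> \<open>After \<open>reg\<close>, the canonical image of \<open>z\<close> is the
        outermost functional in $g^{****}$ and becomes evaluation at \<open>z\<close>; one more star
        leaves \<open>y\<close> applied to an element of $Y^*$ that does not depend on
        \<open>y\<close>.\<close>
      also have "\<dots> = y (app (f\<^sup>r\<^sup>\<star>\<^sup>\<star>) x w z)"
        using f reg[OF x y canon_mem(2)[OF f z] w] w x y z by simp
      finally show "app (f\<^sup>\<star>\<^sup>\<star>\<^sup>\<star>\<^sup>r\<^sup>\<star>) x w (canon (src3 f) z) y = canon (dual (src2 f)) (app (f\<^sup>r\<^sup>\<star>\<^sup>\<star>) x w z) y"
        using y by simp
    qed (use f x w z in \<open>simp_all add: canon_mem canon_mem_bidual normed_space_dual normed_trimap_def[of f]\<close>)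
    with f show ?thesis by (auto simp: image3_def)
  qed
  show ?im3
  proof -
    have "app (f\<^sup>\<star>\<^sup>\<star>\<^sup>\<star>\<^sup>\<star>\<^sup>\<star>) (canon (dual (tgt f)) w) x y = canon (dual (src3 f)) (app (f\<^sup>r\<^sup>\<star>\<^sup>\<star>\<^sup>\<star>) y x w)"
      if w: "w \<in> pts (dual (tgt f))" and x: "x \<in> pts (bidual (src1 f))" and y: "y \<in> pts (bidual (src2 f))"
      for w x y
    proof (rule dual_eqI[where E="bidual (src3 f)"])
      fix z assume z: "z \<in> pts (bidual (src3 f))"
      have "app (f\<^sup>\<star>\<^sup>\<star>\<^sup>\<star>\<^sup>\<star>\<^sup>\<star>) (canon (dual (tgt f)) w) x y z = app (f\<^sup>\<star>\<^sup>\<star>\<^sup>\<star>\<^sup>\<star>) x y z w"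
        using f x y z w by simp
      \<comment> \<open>In $g^{****}(z,y,x)$ the argument \<open>z\<close> is outermost, so the
        value at \<open>w\<close> is \<open>z\<close> applied to a functional independent of
        \<open>z\<close>.\<close>
      also have "\<dots> = z (app (f\<^sup>r\<^sup>\<star>\<^sup>\<star>\<^sup>\<star>) y x w)"
        using reg[OF x y z w] w by simp
      finally show "app (f\<^sup>\<star>\<^sup>\<star>\<^sup>\<star>\<^sup>\<star>\<^sup>\<star>) (canon (dual (tgt f)) w) x y z = canon (dual (src3 f)) (app (f\<^sup>r\<^sup>\<star>\<^sup>\<star>\<^sup>\<star>) y x w) z"
        using z by simp
    qed (use f x w y in \<open>simp_all add: canon_dual_mem canon_mem_bidual normed_space_dual normed_trimap_def[of f]\<close>)
    with f show ?thesis by (auto simp: image3_def)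
  qed
next
  assume "?im2 \<and> ?im3"
  then have im2: ?im2 and im3: ?im3 by auto
  show "regular f"
    unfolding regular_iff[OF f]
  proof (intro ballI)
    fix x y z w
    assume x: "x \<in> pts (bidual (src1 f))" and y: "y \<in> pts (bidual (src2 f))"
      and z: "z \<in> pts (bidual (src3 f))" and w: "w \<in> pts (dual (tgt f))"
    \<comment> \<open>Base of the interchange: with both arguments canonical, either side sends $a$
      in $X$ to $w(f(a,v,u))$.\<close>
    have dx: "app (f\<^sup>\<star>\<^sup>\<star>\<^sup>\<star>) (canon (src2 f) v) (canon (src3 f) u) w = app (f\<^sup>r\<^sup>\<star>) w u v"
      if "v \<in> pts (src2 f)" "u \<in> pts (src3 f)" for u v
      using f w that by (intro dual_eqI[where E="src1 f"]) (simp_all add: canon_mem)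
    have dy: "app (f\<^sup>\<star>\<^sup>\<star>\<^sup>\<star>\<^sup>\<star>) x y (canon (src3 f) u) w = y (app (f\<^sup>r\<^sup>\<star>\<^sup>\<star>) x w u)" if u: "u \<in> pts (src3 f)" for u
    proof -
      obtain \<eta> where \<eta>: "\<eta> \<in> pts (dual (src2 f))"
        and eq: "app (f\<^sup>\<star>\<^sup>\<star>\<^sup>\<star>\<^sup>r\<^sup>\<star>) x w (canon (src3 f) u) = canon (dual (src2 f)) \<eta>"
        using im2 x w u unfolding image3_def by blast
      \<comment> \<open>A single \<open>\<eta>\<close> serves every \<open>v\<close> in $Y^{**}$:
        canonical \<open>v\<close> identify it by way of \<open>dx\<close>, and \<open>v = y\<close>
        then gives the claim.\<close>
      have ev: "app (f\<^sup>\<star>\<^sup>\<star>\<^sup>\<star>\<^sup>\<star>) x v (canon (src3 f) u) w = v \<eta>" if "v \<in> pts (bidual (src2 f))" for v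
        using fun_cong[OF eq, of v] w that by simp
      have "\<eta> = app (f\<^sup>r\<^sup>\<star>\<^sup>\<star>) x w u"
      proof (rule dual_eqI[where E="src2 f"])
        fix v assume v: "v \<in> pts (src2 f)"
        show "\<eta> v = app (f\<^sup>r\<^sup>\<star>\<^sup>\<star>) x w u v"
          using ev[OF canon_mem(1)[OF f v]] \<eta> v u w by (simp add: dx)
      qed (use f x w u \<eta> in simp_all)
      with ev[OF y] show ?thesis by simp
    qed
    obtain \<zeta> where \<zeta>: "\<zeta> \<in> pts (dual (src3 f))"
      and eq: "app (f\<^sup>\<star>\<^sup>\<star>\<^sup>\<star>\<^sup>\<star>\<^sup>\<star>) (canon (dual (tgt f)) w) x y = canon (dual (src3 f)) \<zeta>"
      using im3 x w y unfolding image3_def by blast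
    \<comment> \<open>The same device in the third variable: canonical \<open>u\<close> identify
      \<open>\<zeta>\<close> by way of \<open>dy\<close>, and \<open>u = z\<close> then reaches
      arbitrary \<open>z\<close>.\<close>
    have ev: "app (f\<^sup>\<star>\<^sup>\<star>\<^sup>\<star>\<^sup>\<star>) x y u w = u \<zeta>" if "u \<in> pts (bidual (src3 f))" for u
      using fun_cong[OF eq, of u] f x y w that by simp
    have "\<zeta> = app (f\<^sup>r\<^sup>\<star>\<^sup>\<star>\<^sup>\<star>) y x w"
    proof (rule dual_eqI[where E="src3 f"])
      fix u assume u: "u \<in> pts (src3 f)"
      show "\<zeta> u = app (f\<^sup>r\<^sup>\<star>\<^sup>\<star>\<^sup>\<star>) y x w u"
        using ev[OF canon_mem(2)[OF f u]] dy[OF u] \<zeta> u by simp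
    qed (use f x w y \<zeta> in simp_all)
    with ev[OF z] w show "app (f\<^sup>\<star>\<^sup>\<star>\<^sup>\<star>\<^sup>\<star>) x y z w = app (f\<^sup>r\<^sup>\<star>\<^sup>\<star>\<^sup>\<star>\<^sup>\<star>) z y x w" by simp
  qed
qed

theorem theorem2p2:
  fixes X :: "('k::real_normed_field, 'x::ab_group_add) nspace"
    and Y :: "('k, 'y::ab_group_add) nspace"
    and Z :: "('k, 'z::ab_group_add) nspace"
    and W :: "('k, 'w::ab_group_add) nspace"
    and f :: "('k, 'x, 'y, 'z, 'w) trimap"
  assumes "normed_space X" and "normed_space Y" and "normed_space Z" and "normed_space W"
    and "src1 f = X" and "src2 f = Y" and "src3 f = Z" and "tgt f = W"
    and "bounded_trilinear f"
  shows
    "(regular f \<longleftrightarrow>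
        (\<forall>w\<in>pts (dual (bidual W)). \<forall>x\<in>pts (bidual X). \<forall>y\<in>pts (bidual Y).
           app (f\<^sup>\<star>\<^sup>\<star>\<^sup>\<star>\<^sup>\<star>\<^sup>\<star>) w x y =
           app (f\<^sup>r\<^sup>\<star>\<^sup>\<star>\<^sup>\<star>\<^sup>\<star>\<^sup>\<star>\<^sup>\<star>\<^sup>\<star>\<^sup>r) w (canon (bidual X) x) (canon (bidual Y) y)))
     \<and>
     (regular f \<longleftrightarrow>
        image3 (f\<^sup>\<star>\<^sup>\<star>\<^sup>\<star>\<^sup>r\<^sup>\<star>) (pts (bidual X)) (pts (dual W)) (canon Z ` pts Z)
          \<subseteq> canon (dual Y) ` pts (dual Y)
        \<and>
        image3 (f\<^sup>\<star>\<^sup>\<star>\<^sup>\<star>\<^sup>\<star>\<^sup>\<star>) (canon (dual W) ` pts (dual W)) (pts (bidual X)) (pts (bidual Y))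
          \<subseteq> canon (dual Z) ` pts (dual Z))"
proof -
  have "normed_trimap f" using assms by (simp add: normed_trimap_def)
  from regular_iff_adj5_eq[OF this] regular_iff_adj_images[OF this] show ?thesis
    by (simp only: assms(5-8) simp_thms)
qed

end
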